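(* Let $g(x)=\frac{x\left(\frac{4}{\pi}+\cos x\right)}{\sin x}$ for $0<x<\frac{\pi}{2}$. Then $g$ is a strictly decreasing function. In particular, for all $0<x<\frac{\pi}{2}$ one has $$\frac{1+\cos x}{2}<\frac{\frac{4}{\pi}+\cos x}{\frac{4}{\pi}+1}<\frac{\sin x}{x}<\frac{\frac{4}{\pi}+\cos x}{2}.$$ *)

theory Defs
  imports Complex_Main
begin

definition g :: "real \<Rightarrow> real" where
  "g x = x * (4 / pi + cos x) / sin x"

end

theory Submission
  imports Defs
begin

text \<open>
  With \<open>k = 4 / pi\<close>, the numerator of \<open>g'\<close> is \<open>N x = k * sin x + sin x * cos x - x - k * x * cos x\<close>.
  It vanishes at \<open>0\<close>, and \<open>N' x = sin x * (k * x - 2 * sin x)\<close> is negative by Jordan's inequality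
  \<open>sin x > 2 * x / pi\<close>. Hence \<open>g\<close> decreases strictly on the half-closed interval up to \<open>pi / 2\<close>; the
  two bounds on \<open>sin x / x\<close> compare \<open>g x\<close> with its limit \<open>k + 1\<close> at \<open>0\<close> and its value \<open>2\<close> at \<open>pi / 2\<close>.
\<close>

text \<open>Strict concavity: the chord slopes of \<open>sin\<close> on both sides of
  \<open>x\<close> are \<open>cos a\<close> and \<open>cos b\<close> with \<open>a < x < b\<close>,
  and \<open>cos\<close> strictly decreases, so the left chord is steeper.\<close>

lemma jordan_sin_strict:
  fixes x :: real
  assumes "0 < x" "x < pi / 2"
  shows "2 * x / pi < sin x"
proof -
  obtain a where a: "0 < a" "a < x" "sin x - sin 0 = (x - 0) * cos a"
    using MVT2[of 0 x sin cos] assms by (auto intro: DERIV_sin)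
  obtain b where b: "x < b" "b < pi / 2" "sin (pi / 2) - sin x = (pi / 2 - x) * cos b"
    using MVT2[of x "pi / 2" sin cos] assms by (auto intro: DERIV_sin)
  have "cos b < cos a"
    using a b by (intro cos_monotone_0_pi) auto
  then have "x * (pi / 2 - x) * cos b < x * (pi / 2 - x) * cos a"
    using assms by (intro mult_strict_left_mono) auto
  then have "x * (1 - sin x) < (pi / 2 - x) * sin x"
    using a b by (simp add: mult.assoc mult.left_commute[of x])
  then show ?thesis
    by (simp add: field_simps)
qed

lemma g_deriv_numerator_neg:
  fixes x :: real
  assumes "0 < x" "x < pi / 2"
  shows "4 / pi * sin x + sin x * cos x - x - 4 / pi * x * cos x < 0"
proof -
  define k :: real where "k = 4 / pi"
  define N where "N = (\<lambda>x. k * sin x + sin x * cos x - x - k * x * cos x)"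
  have "N x < N 0"
  proof (rule DERIV_neg_imp_decreasing_open[OF assms(1)])
    fix t assume t: "0 < t" "t < x"
    have "(N has_real_derivative cos t * cos t - sin t * sin t - 1 + k * t * sin t) (at t)"
      unfolding N_def by (auto intro!: derivative_eq_intros simp: algebra_simps)
    moreover have "cos t * cos t - sin t * sin t - 1 + k * t * sin t = sin t * (k * t - 2 * sin t)"
      using sin_cos_squared_add3[of t] by (simp add: algebra_simps)
    moreover have "sin t * (k * t - 2 * sin t) < 0"
      using jordan_sin_strict[of t] sin_gt_zero_02 t assms
      by (intro mult_pos_neg) (auto simp: k_def sin_gt_zero)
    ultimately show "\<exists>y. (N has_real_derivative y) (at t) \<and> y < 0"
      by auto
  next
    show "continuous_on {0..x} N"
      unfolding N_def by (intro continuous_intros)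
  qed
  then show ?thesis
    by (simp add: N_def k_def)
qed

text \<open>The sign of the derivative is needed only in the open interval; continuity at the ends
  lets \<open>y\<close> reach \<open>pi / 2\<close>.\<close>

lemma g_strict_decreasing:
  assumes "0 < x" "x < y" "y \<le> pi / 2"
  shows "g y < g x"
proof (rule DERIV_neg_imp_decreasing_open[OF assms(2)])
  fix t assume t: "x < t" "t < y"
  have s: "sin t > 0"
    using t assms by (intro sin_gt_zero) auto
  let ?N = "4 / pi * sin t + sin t * cos t - t - 4 / pi * t * cos t"
  have "((\<lambda>x. x * (4 / pi + cos x) / sin x) has_real_derivative
      ((1 * (4 / pi + cos t) + t * (0 - sin t)) * sin t - t * (4 / pi + cos t) * cos t)
        / (sin t * sin t)) (at t)"
    using s by (auto intro!: derivative_eq_intros)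
  \<comment> \<open>The sum of squares stays unevaluated here, so that both sides expand to the same
    terms; it is then collapsed to 1 to reach \<open>?N\<close>.\<close>
  moreover have "(1 * (4 / pi + cos t) + t * (0 - sin t)) * sin t - t * (4 / pi + cos t) * cos t
      = 4 / pi * sin t + sin t * cos t - t * (cos t * cos t + sin t * sin t) - 4 / pi * t * cos t"
    by (simp add: algebra_simps del: sin_cos_squared_add3)
  ultimately have "(g has_real_derivative ?N / (sin t * sin t)) (at t)"
    unfolding g_def[abs_def] by (simp only: sin_cos_squared_add3 mult_1_right)
  moreover have "?N / (sin t * sin t) < 0"
    using g_deriv_numerator_neg[of t] s t assms by (intro divide_neg_pos) auto
  ultimately show "\<exists>d. (g has_real_derivative d) (at t) \<and> d < 0"
    by blast
next
  have "sin t \<noteq> 0" if "t \<in> {x..y}" for t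
    using that assms sin_gt_zero[of t] by auto
  then show "continuous_on {x..y} g"
    unfolding g_def[abs_def] by (intro continuous_intros) auto
qed

lemma g_tendsto_at_right_0: "(g \<longlongrightarrow> 4 / pi + 1) (at_right 0)"
proof -
  \<comment> \<open>This quotient is the difference quotient of \<open>sin\<close> at 0, so its
    limit is \<open>cos 0\<close>.\<close>
  have "((\<lambda>x::real. sin x / x) \<longlongrightarrow> 1) (at_right 0)"
    using DERIV_sin[of "0::real"] by (auto simp: DERIV_def intro: filterlim_mono at_le)
  then have "((\<lambda>x::real. (4 / pi + cos x) / (sin x / x)) \<longlongrightarrow> (4 / pi + cos 0) / 1) (at_right 0)"
    by (intro tendsto_intros) auto
  then show ?thesis
    by (simp add: g_def[abs_def] mult.commute)
qed

text \<open>Passing to the limit yields only a weak inequality, so it is applied at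
  \<open>x / 2\<close>; the strict drop from \<open>x / 2\<close> to \<open>x\<close> restores
  strictness.\<close>

lemma g_less_limit_0:
  assumes "0 < x" "x \<le> pi / 2"
  shows "g x < 4 / pi + 1"
proof -
  have "\<forall>\<^sub>F y in at_right 0. g (x / 2) \<le> g y"
    using eventually_at_right_real[of 0 "x / 2"] assms
    by (auto elim!: eventually_mono intro!: less_imp_le g_strict_decreasing)
  then have "g (x / 2) \<le> 4 / pi + 1"
    by (rule tendsto_lowerbound[OF g_tendsto_at_right_0]) simp
  moreover have "g x < g (x / 2)"
    using assms by (intro g_strict_decreasing) auto
  ultimately show ?thesis
    by simp
qed

theorem theorem2:
  shows "strict_antimono_on {0<..<pi / 2} g \<and>
    (\<forall>x::real. 0 < x \<and> x < pi / 2 \<longrightarrow>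
       (1 + cos x) / 2 < (4 / pi + cos x) / (4 / pi + 1) \<and>
       (4 / pi + cos x) / (4 / pi + 1) < sin x / x \<and>
       sin x / x < (4 / pi + cos x) / 2)"
proof (intro conjI allI impI)
  show "strict_antimono_on {0<..<pi / 2} g"
    by (auto intro!: monotone_onI g_strict_decreasing)
next
  fix x :: real
  assume x: "0 < x \<and> x < pi / 2"
  define k :: real where "k = 4 / pi"
  have k: "k > 1"
    using pi_less_4 by (simp add: k_def)
  have s: "sin x > 0"
    using x by (intro sin_gt_zero) auto
  have c: "cos x < 1"
    using x cos_monotone_0_pi[of 0 x] by simp
  \<comment> \<open>This product is the difference of the two sides of the first inequality after
    clearing denominators.\<close>
  have "(k - 1) * (1 - cos x) > 0"
    using k c by simp
  then show "(1 + cos x) / 2 < (4 / pi + cos x) / (4 / pi + 1)"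
    using k unfolding k_def[symmetric] by (simp add: field_simps)
  have "x * (k + cos x) / sin x < k + 1"
    using g_less_limit_0[of x] x by (simp add: g_def k_def)
  then show "(4 / pi + cos x) / (4 / pi + 1) < sin x / x"
    using k s x unfolding k_def[symmetric] by (simp add: field_simps)
  have "2 < x * (k + cos x) / sin x"
    using g_strict_decreasing[of x "pi / 2"] x by (simp add: g_def k_def)
  then show "sin x / x < (4 / pi + cos x) / 2"
    using s x unfolding k_def[symmetric] by (simp add: field_simps)
qed

end
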